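(* Let $n\geq 5$ and let $f:\{0,1\}^n\to\{0,1\}^n$ be any Boolean network. Then $\mathcal{G}(f)\neq\{K_n\}$.
   Context: A Boolean network with $n$ components is a map $f:\{0,1\}^n\to\{0,1\}^n$, $x\mapsto(f_1(x),\dots,f_n(x))$. For $i\in[n]=\{1,\dots,n\}$, $e_i$ denotes the configuration with a $1$ exactly in component $i$, and $x+y$ denotes componentwise addition modulo 2. The interaction graph $G(f)$ is the digraph with vertex set $[n]$ having an arc from $j$ to $i$ (loops $i=j$ allowed) if and only if there is $x\in\{0,1\}^n$ with $f_i(x)\neq f_i(x+e_j)$. Two networks $f,h$ with $n$ components are isomorphic if $h\circ\pi=\pi\circ f$ for some permutation $\pi$ of $\{0,1\}^n$. $\mathcal{G}(f)$ is the set of interaction graphs $G(h)$ of all networks $h$ isomorphic to $f$. $K_n$ denotes the complete digraph on $[n]$ with all $n^2$ arcs (including all loops). *)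

theory Defs
  imports
    "HOL-Analysis.Finite_Cartesian_Product"
    "HOL-Library.Z2"
    "Graph_Theory.Pair_Digraph"
begin

text \<open>
  Configurations are vectors over the two-element field \<^typ>\<open>bit\<close>, indexed by a finite type
  \<open>'n\<close> that plays the role of \<open>{1, ..., n}\<close>, with \<open>n = CARD('n)\<close>.  Addition of vectors is then
  componentwise addition modulo 2, and \<open>e\<^sub>j\<close> is \<open>axis j 1\<close>.
\<close>

type_synonym 'n config = "bit ^ 'n"

type_synonym 'n network = "'n config \<Rightarrow> 'n config"

text \<open>A pair \<open>(j, i)\<close> in \<^const>\<open>parcs\<close> is an arc from \<open>j\<close> to \<open>i\<close>.\<close>

definition interaction_graph :: "'n::finite network \<Rightarrow> 'n pair_pre_digraph" where
  "interaction_graph f =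
    \<lparr> pverts = UNIV, parcs = {(j, i). \<exists>x. f x $ i \<noteq> f (x + axis j 1) $ i} \<rparr>"

definition isomorphic_networks :: "'n::finite network \<Rightarrow> 'n network \<Rightarrow> bool" where
  "isomorphic_networks f h \<longleftrightarrow> (\<exists>\<pi>. bij \<pi> \<and> h \<circ> \<pi> = \<pi> \<circ> f)"

definition interaction_graphs :: "'n::finite network \<Rightarrow> 'n pair_pre_digraph set" where
  "interaction_graphs f = {interaction_graph h | h. isomorphic_networks f h}"

text \<open>The complete digraph here contains all loops.\<close>

definition complete_looped_digraph :: "'n::finite pair_pre_digraph" where
  "complete_looped_digraph = \<lparr> pverts = UNIV, parcs = UNIV \<rparr>"

end

theory Submission
  imports Defs "HOL-Library.Disjoint_Sets"
begin

text \<open>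
  Let \<open>N = 2^n\<close>.  If \<open>A\<close> is a set of \<open>N/2\<close> configurations such that \<open>f\<^sup>-\<^sup>1(A)\<close> and
  \<open>A \<inter> f\<^sup>-\<^sup>1(A)\<close> both have even size, then the configurations can be renamed so that \<open>A\<close> becomes
  \<open>{y. y\<^sub>i = 1}\<close> and \<open>f\<^sup>-\<^sup>1(A)\<close> becomes invariant under \<open>y \<mapsto> y + e\<^sub>j\<close> for some \<open>j \<noteq> i\<close>; the
  resulting isomorphic network has no arc from \<open>j\<close> to \<open>i\<close>.

  To find \<open>A\<close>, look at the leaves (points without preimage) of the functional digraph of \<open>f\<close>.  If there
  are at least \<open>N/2\<close> of them, \<open>A\<close> is a set of leaves.  If two leaves have different images \<open>t\<close>, \<open>t'\<close>,
  exchanging them in a set that contains \<open>t\<close> but not \<open>t'\<close> preserves \<open>|f\<^sup>-\<^sup>1(A)|\<close> and changes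
  \<open>|A \<inter> f\<^sup>-\<^sup>1(A)|\<close> by one; the parity of \<open>|f\<^sup>-\<^sup>1(A)|\<close> can be prescribed unless almost all in-degrees are 1.
  If all leaves have the same image, almost all non-leaves have in-degree 1, and \<open>A\<close> is made of an even number
  of leaves and an even number of points of in-degree 1; each of the latter is entered by a single arc, so that
  exchanging two points at a time adjusts the parity of the number of inner arcs.
\<close>

section \<open>Parity of the number of inner arcs\<close>

lemma even_card_involution:
  assumes "\<And>x. x \<in> X \<Longrightarrow> h x \<in> X" "\<And>x. x \<in> X \<Longrightarrow> h (h x) = x" "\<And>x. x \<in> X \<Longrightarrow> h x \<noteq> x"
  shows "even (card X)"
proof -
  have "(\<Sum>x\<in>X. 1 :: bit) = 0"
    using assms by (intro sum_involution_eq_0[of X _ h]) auto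
  then have "(of_nat (card X) :: bit) = 0"
    by simp
  then show ?thesis
    by (cases "even (card X)") (auto elim!: oddE)
qed

definition inner_arcs :: "('a \<Rightarrow> 'a) \<Rightarrow> 'a set \<Rightarrow> nat" where
  "inner_arcs f T = card (T \<inter> f -` T)"

text \<open>As a double sum the count is a quadratic form in the indicator of \<open>T\<close>, so
  it can be expanded when points are inserted.\<close>

lemma inner_arcs_eq_sum:
  assumes "finite T"
  shows "inner_arcs f T = (\<Sum>a\<in>T. \<Sum>b\<in>T. of_bool (f a = b))"
proof -
  have "(\<Sum>a\<in>T. \<Sum>b\<in>T. of_bool (f a = b)) = (\<Sum>a\<in>T. of_bool (f a \<in> T) :: nat)"
    using assms by (intro sum.cong refl) (auto simp: of_bool_def sum.delta)
  also have "\<dots> = card (T \<inter> f -` T)"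
    using assms by (simp add: of_bool_def sum.If_cases vimage_def Int_def)
  finally show ?thesis
    by (simp add: inner_arcs_def)
qed

text \<open>The mixed second difference of the quadratic form \<^const>\<open>inner_arcs\<close> does not depend on \<open>B\<close>.\<close>

lemma inner_arcs_exchange:
  fixes f :: "'a \<Rightarrow> 'a"
  defines "M \<equiv> \<lambda>x y. of_bool (f x = y) + of_bool (f y = x) :: nat"
  assumes "finite B" "{u, v, w, z} \<inter> B = {}" "u \<notin> {w, z}" "v \<notin> {w, z}"
    and "odd (inner_arcs f (insert u (insert w B)))" "odd (inner_arcs f (insert v (insert w B)))"
      "odd (inner_arcs f (insert u (insert z B)))" "odd (inner_arcs f (insert v (insert z B)))"
  shows "even (M u w + M v w + M u z + M v z)"
proof -
  define g where "g x y = (of_bool (f x = y) :: nat)" for x y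
  \<comment> \<open>\<open>c x\<close> gathers the loop at \<open>x\<close> and the arcs between
    \<open>x\<close> and \<open>B\<close>. Each of \<open>u\<close>, \<open>v\<close>,
    \<open>w\<close>, \<open>z\<close> lies in two of the four sets, so these terms cancel modulo 2
    and only the values of \<open>M\<close> survive.\<close>
  define c where "c x = g x x + (\<Sum>b\<in>B. g b x) + (\<Sum>b\<in>B. g x b)" for x
  have eq: "inner_arcs f T = (\<Sum>a\<in>T. \<Sum>b\<in>T. g a b)" if "finite T" for T
    using inner_arcs_eq_sum[OF that] by (simp only: g_def)
  have M: "M x y = g x y + g y x" for x y
    by (simp only: M_def g_def)
  have ins: "inner_arcs f (insert x (insert y B)) = inner_arcs f B + c x + c y + M x y"
    if "x \<notin> B" "y \<notin> B" "x \<noteq> y" for x y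
    using that assms(2) by (simp add: eq M c_def sum.distrib)
  have d: "u \<notin> B" "v \<notin> B" "w \<notin> B" "z \<notin> B" "u \<noteq> w" "u \<noteq> z" "v \<noteq> w" "v \<noteq> z"
    using assms by auto
  show ?thesis
    using assms(6-9) unfolding ins[OF d(1,3,5)] ins[OF d(2,3,7)] ins[OF d(1,4,6)] ins[OF d(2,4,8)]
    by presburger
qed

text \<open>If every \<open>j\<close>-subset had an odd count, the exchange identity would force
  \<open>f (f x) = x\<close> whenever \<open>x\<close> and \<open>f x\<close> lie in
  \<open>S\<close>. Inner arcs other than loops then pair up, so every \<open>j\<close>-subset
  contains an odd number of fixed points. Exchanging a fixed point for another point breaks this; if
  no point or every point of \<open>S\<close> is fixed, the number is 0 or \<open>j\<close>, which
  is even.\<close>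

lemma even_inner_arcs_subset:
  assumes "finite S" "even j" "2 \<le> j" "j + 2 \<le> card S" "10 \<le> card S"
    and inj: "\<And>x y. x \<in> S \<Longrightarrow> y \<in> S \<Longrightarrow> f x = f y \<Longrightarrow> f x \<in> S \<Longrightarrow> x = y"
  shows "\<exists>T\<subseteq>S. card T = j \<and> even (inner_arcs f T)"
proof (rule ccontr)
  assume "\<not> ?thesis"
  then have odd: "odd (inner_arcs f T)" if "T \<subseteq> S" "card T = j" for T
    using that by blast
  have "f (f x) = x" if x: "x \<in> S" "f x \<in> S" for x
  proof (rule ccontr)
    assume ne: "f (f x) \<noteq> x"
    let ?y = "f x"
    have "?y \<noteq> x" using ne by metis
    have "card {x, ?y, f ?y} \<le> 3" by (simp add: card_insert_if)
    then have "\<not> S \<subseteq> {x, ?y, f ?y}" using assms(5) card_mono[of "{x, ?y, f ?y}" S] by force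
    then obtain v where v: "v \<in> S" "v \<notin> {x, ?y, f ?y}" by blast
    have pre: "card {z \<in> S. f z = a} \<le> 1" if "a \<in> S" for a
      using that inj assms(1) by (auto simp: card_le_Suc0_iff_eq)
    \<comment> \<open>A point \<open>z\<close> outside these at most six points is joined to neither
      \<open>x\<close> nor \<open>v\<close>. Between \<open>{x, v}\<close> and
      \<open>{?y, z}\<close> the only arc is then the one from \<open>x\<close> to
      \<open>?y\<close>, so the exchange sum is 1, which is odd.\<close>
    let ?F = "{x, ?y, v, f v} \<union> ({z \<in> S. f z = x} \<union> {z \<in> S. f z = v})"
    have "card ?F \<le> card {x, ?y, v, f v} + (card {z \<in> S. f z = x} + card {z \<in> S. f z = v})"
      by (meson card_Un_le add_left_mono order_trans)
    also have "\<dots> \<le> 4 + (1 + 1)"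
      using x v pre by (intro add_mono) (auto simp: card_insert_if)
    finally have "\<not> S \<subseteq> ?F"
      using assms(1,5) card_mono[of ?F S] by force
    then obtain z where z: "z \<in> S" "z \<notin> ?F" by blast
    let ?R = "S - {x, v, ?y, z}"
    have "card {x, v, ?y, z} = 4" using v z x \<open>?y \<noteq> x\<close> by auto
    then have "j - 2 \<le> card ?R"
      using x v z assms by (subst card_Diff_subset) auto
    then obtain B where B: "B \<subseteq> ?R" "card B = j - 2" "finite B"
      using obtain_subset_with_card_n by metis
    have "odd (inner_arcs f (insert a (insert b B)))"
      if "a \<in> {x, v}" "b \<in> {?y, z}" for a b
    proof (rule odd)
      have "a \<notin> insert b B" "b \<notin> B" "insert a (insert b B) \<subseteq> S"
        using that B v z x \<open>?y \<noteq> x\<close> by auto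
      then show "insert a (insert b B) \<subseteq> S" "card (insert a (insert b B)) = j"
        using B assms(3) by auto
    qed
    moreover have "f v \<noteq> ?y" using inj[of v x] v x by auto
    moreover have "{x, v, ?y, z} \<inter> B = {}" using B by blast
    ultimately show False
      using inner_arcs_exchange[of B x v ?y z f] B(3) v z ne \<open>?y \<noteq> x\<close> by auto
  qed
  note inv = this
  define F where "F = {x \<in> S. f x = x}"
  have parity: "odd (card (T \<inter> F))" if T: "T \<subseteq> S" "card T = j" for T
  proof -
    let ?X = "{x \<in> T. f x \<in> T \<and> f x \<noteq> x}"
    have fin: "finite T" using T assms(1) finite_subset by blast
    have "T \<inter> f -` T = (T \<inter> F) \<union> ?X" using T by (auto simp: F_def)
    then have "inner_arcs f T = card (T \<inter> F) + card ?X"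
      unfolding inner_arcs_def using fin
      by (simp only:) (rule card_Un_disjoint, auto simp: F_def)
    moreover have "even (card ?X)"
    proof (rule even_card_involution[of _ f])
      fix x assume "x \<in> ?X"
      then have "x \<in> T" "f x \<in> T" "f x \<noteq> x" "f (f x) = x"
        using T inv by auto
      then show "f x \<in> ?X" "f (f x) = x" "f x \<noteq> x" by auto
    qed
    ultimately show ?thesis using odd[OF T] by simp
  qed
  have "j \<le> card S" using assms by simp
  then obtain T where T: "T \<subseteq> S" "card T = j"
    by (meson obtain_subset_with_card_n)
  consider "F = {}" | "F = S" | a b where "a \<in> F" "b \<in> S - F"
    using F_def by blast
  then show False
  proof cases
    case 3
    have "card (S - {a, b}) = card S - 2" using 3 assms(1)
      by (subst card_Diff_subset) (auto simp: F_def card_insert_if)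
    then have "j - 1 \<le> card (S - {a, b})" using assms by simp
    then obtain B where B: "B \<subseteq> S - {a, b}" "card B = j - 1" "finite B"
      using obtain_subset_with_card_n by metis
    have "insert a B \<subseteq> S" "insert b B \<subseteq> S" "card (insert a B) = j" "card (insert b B) = j"
      using B 3 assms(3) by (auto simp: F_def card_insert_if)
    then have "odd (card (insert a B \<inter> F))" "odd (card (insert b B \<inter> F))"
      using parity[of "insert a B"] parity[of "insert b B"] by blast+
    moreover have "insert a B \<inter> F = insert a (B \<inter> F)" "insert b B \<inter> F = B \<inter> F"
      "a \<notin> B \<inter> F"
      using 3 B by auto
    ultimately show False using B by simp
  qed (use parity[OF T] T assms(2) in \<open>auto simp: Int_absorb2\<close>)
qed

section \<open>In-degrees and balanced splits\<close>

definition indeg :: "('a \<Rightarrow> 'a) \<Rightarrow> 'a \<Rightarrow> nat" where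
  "indeg f x = card (f -` {x})"

lemma card_vimage_eq_sum_indeg:
  fixes f :: "'a::finite \<Rightarrow> 'a"
  shows "card (f -` A) = (\<Sum>x\<in>A. indeg f x)"
proof -
  have "f -` A = (\<Union>x\<in>A. f -` {x})" by auto
  then show ?thesis
    unfolding indeg_def by (simp only:) (rule card_UN_disjoint, auto)
qed

lemma sum_indeg_UNIV:
  fixes f :: "'a::finite \<Rightarrow> 'a"
  shows "(\<Sum>x\<in>UNIV. indeg f x) = CARD('a)"
  using card_vimage_eq_sum_indeg[of f UNIV] by simp

lemma indeg_eq_0_iff:
  fixes f :: "'a::finite \<Rightarrow> 'a"
  shows "indeg f x = 0 \<longleftrightarrow> x \<notin> range f"
  by (auto simp: indeg_def)

definition balanced_split :: "('a::finite \<Rightarrow> 'a) \<Rightarrow> 'a set \<Rightarrow> bool" where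
  "balanced_split f A \<longleftrightarrow>
    2 * card A = CARD('a) \<and> even (card (f -` A)) \<and> even (inner_arcs f A)"

text \<open>The split is \<open>L \<union> T\<close> with \<open>T \<subseteq> S\<close>. Leaves
  have in-degree 0, so the preimage has \<open>card T\<close> points; no arc enters \<open>L\<close>
  and none goes from \<open>L\<close> to \<open>T\<close>, so the inner arcs are those of
  \<open>T\<close>. The two bounds in \<open>le\<close> leave room for
  \<open>2 \<le> card T \<le> card S - 2\<close>.\<close>

lemma balanced_split_leaves_ones:
  fixes f :: "'a::finite \<Rightarrow> 'a"
  assumes N: "4 dvd CARD('a)"
    and S: "\<And>x. x \<in> S \<Longrightarrow> indeg f x = 1" "10 \<le> card S"
    and L: "L \<inter> range f = {}" "f ` L \<inter> S = {}" "even (card L)"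
    and le: "2 * card L < CARD('a)" "CARD('a) + 4 \<le> 2 * card L + 2 * card S"
  shows "\<exists>A. balanced_split f A"
proof -
  obtain q where q: "CARD('a) = 4 * q" using N by (elim dvdE)
  obtain l where l: "card L = 2 * l" using L(3) by (elim evenE)
  let ?j = "2 * q - 2 * l"
  have inj: "x = y" if "x \<in> S" "y \<in> S" "f x = f y" "f x \<in> S" for x y
  proof -
    have "card (f -` {f x}) = 1" using S(1)[OF that(4)] by (simp add: indeg_def)
    then show ?thesis using that by (auto simp: card_1_singleton_iff set_eq_iff)
  qed
  have "\<exists>T\<subseteq>S. card T = ?j \<and> even (inner_arcs f T)"
  proof (rule even_inner_arcs_subset)
    have "finite S" using S(2) by (simp add: card_ge_0_finite)
    then show "finite S" .
    show "x = y" if "x \<in> S" "y \<in> S" "f x = f y" "f x \<in> S" for x y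
      using inj that by blast
  qed (use le q l S in auto)
  then obtain T where T: "T \<subseteq> S" "card T = ?j" "even (inner_arcs f T)" by blast
  have rT: "T \<subseteq> range f"
  proof
    fix x assume "x \<in> T"
    then have "indeg f x = 1" using T S by blast
    then show "x \<in> range f" using indeg_eq_0_iff[of f x] by linarith
  qed
  then have disj: "L \<inter> T = {}" using L by auto
  have "2 * card (L \<union> T) = CARD('a)"
    using disj T l q le by (simp add: card_Un_disjoint)
  moreover have "card (f -` (L \<union> T)) = (\<Sum>x\<in>L. indeg f x) + (\<Sum>x\<in>T. indeg f x)"
    unfolding card_vimage_eq_sum_indeg using disj by (simp add: sum.union_disjoint)
  moreover have "(\<Sum>x\<in>L. indeg f x) = 0"
    using L(1) by (auto simp: indeg_eq_0_iff)
  moreover have "(\<Sum>x\<in>T. indeg f x) = card T"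
    using T S by (subst sum.cong[OF refl, of _ _ "\<lambda>_. 1"]) auto
  moreover have "(L \<union> T) \<inter> f -` (L \<union> T) = T \<inter> f -` T"
    using L T rT by auto
  ultimately show ?thesis using T
    by (intro exI[of _ "L \<union> T"]) (simp add: balanced_split_def inner_arcs_def)
qed

text \<open>Add either \<open>v\<close> or \<open>v'\<close> to \<open>insert (f v) B\<close>. Both
  sets have the same in-degree sum, but the arc leaving \<open>v\<close> is inner while the one
  leaving \<open>v'\<close> is not, so exactly one of them has an even number of inner arcs.\<close>

lemma balanced_split_swap_leaves:
  fixes f :: "'a::finite \<Rightarrow> 'a"
  assumes "v \<notin> range f" "v' \<notin> range f" "f v \<noteq> f v'"
    and B: "B \<subseteq> - {v, v', f v, f v'}" "2 * card B + 4 = CARD('a)"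
      "even ((\<Sum>x\<in>B. indeg f x) + indeg f (f v))"
  shows "\<exists>A. balanced_split f A"
proof -
  have ne: "v \<noteq> v'" "f v \<noteq> v" "f v \<noteq> v'" "f v' \<noteq> v" "f v' \<noteq> v'"
    using assms by (metis rangeI)+
  let ?C = "insert (f v) B"
  have notin: "v \<notin> ?C" "v' \<notin> ?C" "f v \<notin> B" "f v' \<notin> ?C"
    using ne B assms(3) by auto
  have card: "2 * card (insert v ?C) = CARD('a)" "2 * card (insert v' ?C) = CARD('a)"
    using notin B(2) by auto
  have deg0: "indeg f v = 0" "indeg f v' = 0" using assms by (simp_all add: indeg_eq_0_iff)
  then have deg: "even (card (f -` insert v ?C))" "even (card (f -` insert v' ?C))"
    unfolding card_vimage_eq_sum_indeg using notin B(3) by (simp_all add: add.commute)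
  have "f x \<noteq> v" "f x \<noteq> v'" for x
    using assms(1,2) by auto
  then have "insert v ?C \<inter> f -` insert v ?C = insert v (?C \<inter> f -` ?C)"
    "insert v' ?C \<inter> f -` insert v' ?C = ?C \<inter> f -` ?C"
    using notin ne by auto
  then have "inner_arcs f (insert v ?C) = Suc (inner_arcs f (insert v' ?C))"
    unfolding inner_arcs_def using notin by simp
  then have "even (inner_arcs f (insert v ?C)) \<or> even (inner_arcs f (insert v' ?C))"
    by simp
  then show ?thesis
    unfolding balanced_split_def using card deg by blast
qed

text \<open>If both parities of \<open>d\<close> occur in \<open>R\<close>, exchanging
  \<open>a\<close> for \<open>b\<close> changes the parity of the sum; \<open>m < card R\<close>
  leaves room for \<open>m - 1\<close> common points. If only one parity occurs, an even number of
  terms has an even sum.\<close>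

lemma even_sum_subset_exists:
  fixes d :: "'a \<Rightarrow> nat"
  assumes "finite R" "even m" "m < card R"
  shows "\<exists>B\<subseteq>R. card B = m \<and> even (sum d B)"
    and "a \<in> R \<Longrightarrow> b \<in> R \<Longrightarrow> even (d a) \<Longrightarrow> odd (d b) \<Longrightarrow> 0 < m
      \<Longrightarrow> \<exists>B\<subseteq>R. card B = m \<and> odd (sum d B)"
proof -
  have mixed: "\<exists>B\<subseteq>R. card B = m \<and> even (sum d B) = p"
    if ab: "a \<in> R" "b \<in> R" "even (d a)" "odd (d b)" "0 < m" for p a b
  proof -
    have ne: "a \<noteq> b" using ab by auto
    then have "card (R - {a, b}) = card R - 2" using ab assms(1)
      by (subst card_Diff_subset) (auto simp: card_insert_if)
    then have "m - 1 \<le> card (R - {a, b})" using assms by simp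
    then obtain C where C: "C \<subseteq> R - {a, b}" "card C = m - 1" "finite C"
      using obtain_subset_with_card_n by metis
    have *: "a \<notin> C" "b \<notin> C" "C \<subseteq> R" using C by auto
    then have "card (insert a C) = m" "card (insert b C) = m"
      "even (sum d (insert a C)) \<noteq> even (sum d (insert b C))"
      using C ab by auto
    moreover have "insert a C \<subseteq> R" "insert b C \<subseteq> R" using * ab by auto
    ultimately show ?thesis by metis
  qed
  then show "a \<in> R \<Longrightarrow> b \<in> R \<Longrightarrow> even (d a) \<Longrightarrow> odd (d b) \<Longrightarrow> 0 < m
      \<Longrightarrow> \<exists>B\<subseteq>R. card B = m \<and> odd (sum d B)"
    by (metis (full_types))
  show "\<exists>B\<subseteq>R. card B = m \<and> even (sum d B)"
  proof (cases "m > 0 \<and> (\<exists>a\<in>R. even (d a)) \<and> (\<exists>b\<in>R. odd (d b))")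
    case True
    then show ?thesis using mixed[of _ _ True] by auto
  next
    case False
    have "m \<le> card R" using assms by simp
    then obtain B where B: "B \<subseteq> R" "card B = m" "finite B"
      by (meson obtain_subset_with_card_n)
    have "{x \<in> B. odd (d x)} = {} \<or> {x \<in> B. odd (d x)} = B"
      using False B by (cases "m = 0") auto
    then have "even (sum d B)"
      using B assms(2) unfolding even_sum_iff[OF B(3)] by (elim disjE) (simp_all only: card.empty even_zero)
    then show ?thesis using B by blast
  qed
qed

section \<open>Existence of a balanced split\<close>

lemma balanced_split_exists:
  fixes f :: "'a::finite \<Rightarrow> 'a"
  assumes N: "4 dvd CARD('a)" "32 \<le> CARD('a)"
  shows "\<exists>A. balanced_split f A"
proof -
  define L where "L = - range f"
  obtain q where q: "CARD('a) = 4 * q" using N by (elim dvdE)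
  have L0: "x \<in> L \<longleftrightarrow> indeg f x = 0" for x
    by (simp add: L_def indeg_eq_0_iff)
  have fL: "f x \<notin> L" for x by (simp add: L_def)
  have total: "(\<Sum>x\<in>X. indeg f x) + (\<Sum>x\<in>-X. indeg f x) = CARD('a)" for X
    using sum.subset_diff[of X UNIV "indeg f"] by (simp add: sum_indeg_UNIV Compl_eq_Diff_UNIV add.commute)
  have cardC: "card (- X) = CARD('a) - card X" for X :: "'a set"
    by (simp add: Compl_eq_Diff_UNIV card_Diff_subset)
  consider (many) "2 * q \<le> card L"
    | (same) t where "card L < 2 * q" "f ` L \<subseteq> {t}"
    | (differ) v v' where "card L < 2 * q" "v \<in> L" "v' \<in> L" "f v \<noteq> f v'"
  proof (cases "2 * q \<le> card L")
    case False
    then have less: "card L < 2 * q" by simp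
    show ?thesis
    proof (cases "\<exists>v\<in>L. \<exists>v'\<in>L. f v \<noteq> f v'")
      case True
      then show ?thesis using differ less by blast
    next
      case False
      \<comment> \<open>If \<open>L\<close> is empty, the chosen point is arbitrary and the
        inclusion is vacuous.\<close>
      have "f ` L \<subseteq> {f (SOME v. v \<in> L)}"
      proof clarify
        fix v assume "v \<in> L"
        then have "(SOME v. v \<in> L) \<in> L" by (rule someI)
        then show "f v = f (SOME v. v \<in> L)" using False \<open>v \<in> L\<close> by blast
      qed
      then show ?thesis using same less by blast
    qed
  qed (rule many)
  then show ?thesis
  proof cases
    case many
    then obtain A where A: "A \<subseteq> L" "card A = 2 * q" "finite A"
      using obtain_subset_with_card_n by metis
    then have "f -` A = {}" using fL by auto
    then show ?thesis
      using A q by (intro exI[of _ A]) (simp add: balanced_split_def inner_arcs_def)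
  next
    case same
    \<comment> \<open>The leaves use up \<open>card L\<close> arcs into \<open>t\<close>. At most
      \<open>card I + 1\<close> arcs remain for the points of \<open>I\<close>, each entered at
      least once, so at most one of them has in-degree above 1.\<close>
    define I where "I = - (L \<union> {t})"
    define S where "S = {x \<in> I. indeg f x = 1}"
    have "card (L \<union> {t}) \<le> card L + 1"
      using card_Un_le[of L "{t}"] by simp
    then have cardI: "CARD('a) \<le> card I + card L + 1"
      using cardC[of "L \<union> {t}"] unfolding I_def by linarith
    have "card L \<le> indeg f t"
      unfolding indeg_def using same by (intro card_mono) auto
    also have "indeg f t \<le> (\<Sum>x\<in>-I. indeg f x)"
      by (intro member_le_sum) (auto simp: I_def)
    finally have sumI: "(\<Sum>x\<in>I. indeg f x) + card L \<le> CARD('a)"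
      using total[of I] by simp
    have "indeg f x \<ge> 1 + of_bool (x \<notin> S)" if "x \<in> I" for x
      using that L0[of x] by (auto simp: S_def I_def)
    then have "(\<Sum>x\<in>I. 1 + of_bool (x \<notin> S)) \<le> (\<Sum>x\<in>I. indeg f x)"
      by (intro sum_mono) auto
    moreover have "(\<Sum>x\<in>I. 1 + of_bool (x \<notin> S)) = card I + card (I - S)"
      unfolding sum.distrib by (simp add: Diff_eq Compl_eq)
    moreover have "card (I - S) = card I - card S" "card S \<le> card I"
      by (auto simp: S_def card_Diff_subset intro: card_mono)
    ultimately have cardS: "CARD('a) \<le> card S + card L + 2"
      using sumI cardI by linarith
    \<comment> \<open>One leaf is dropped if \<open>card L\<close> is odd.\<close>
    have "2 * (card L div 2) \<le> card L" by simp
    then obtain L' where L': "L' \<subseteq> L" "card L' = 2 * (card L div 2)" "finite L'"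
      using obtain_subset_with_card_n by metis
    show ?thesis
    proof (rule balanced_split_leaves_ones)
      show "L' \<inter> range f = {}" using L' by (auto simp: L_def)
      show "f ` L' \<inter> S = {}" using L' same by (auto simp: S_def I_def)
      show "2 * card L' < CARD('a)" using L'(2) same(1) q by simp
      show "CARD('a) + 4 \<le> 2 * card L' + 2 * card S"
        using L'(2) same(1) q cardS N by linarith
      show "10 \<le> card S" using q cardS same(1) N by linarith
    qed (use N L' in \<open>auto simp: S_def\<close>)
  next
    case differ
    let ?t = "f v" and ?t' = "f v'"
    define R where "R = - {v, v', ?t, ?t'}"
    have dist: "v \<noteq> v'" "v \<noteq> ?t" "v \<noteq> ?t'" "v' \<noteq> ?t" "v' \<noteq> ?t'"
      using differ fL by metis+
    have swap: "\<exists>A. balanced_split f A"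
      if "u \<in> L" "u' \<in> L" "f u \<noteq> f u'" "B \<subseteq> - {u, u', f u, f u'}" "card B = 2 * q - 2"
        "even (\<Sum>x\<in>B. indeg f x) = even (indeg f (f u))" for u u' B
    proof (rule balanced_split_swap_leaves[OF _ _ that(3,4)])
      show "u \<notin> range f" "u' \<notin> range f" using that(1,2) by (simp_all add: L_def)
      show "2 * card B + 4 = CARD('a)" using that(5) q N by simp
    qed (use that(6) in simp)
    have cardR: "2 * q - 2 < card (- {u, u', f u, f u'})" for u u'
    proof -
      have "card {u, u', f u, f u'} \<le> 4" by (simp add: card_insert_if)
      then show ?thesis using cardC[of "{u, u', f u, f u'}"] q N by linarith
    qed
    have evens: "\<exists>A. balanced_split f A"
      if "u \<in> L" "u' \<in> L" "f u \<noteq> f u'" "even (indeg f (f u))" for u u'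
      using even_sum_subset_exists(1)[OF _ _ cardR, of u u' "indeg f"] swap[OF that(1-3)] that(4)
      by auto
    \<comment> \<open>The sum over \<open>B\<close> must have the parity of
      \<open>indeg f ?t\<close>. An even sum is always attainable; an odd one is available if both
      parities occur in \<open>R\<close>. The last two cases have a constant parity on
      \<open>R\<close>.\<close>
    consider (even) "even (indeg f ?t) \<or> even (indeg f ?t')"
      | (mixed) a b where "odd (indeg f ?t)" "a \<in> R" "b \<in> R" "even (indeg f a)" "odd (indeg f b)"
      | (odds) "odd (indeg f ?t)" "odd (indeg f ?t')" "\<forall>x\<in>R. odd (indeg f x)"
      | (eves) "odd (indeg f ?t)" "odd (indeg f ?t')" "\<forall>x\<in>R. even (indeg f x)"
      by blast
    then show ?thesis
    proof cases
      case even
      then show ?thesis using evens differ by metis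
    next
      case mixed
      have "0 < 2 * q - 2" using N q by simp
      then obtain B where "B \<subseteq> R" "card B = 2 * q - 2" "odd (sum (indeg f) B)"
        using even_sum_subset_exists(2)[of R "2 * q - 2" a b "indeg f"] mixed cardR[of v v']
        unfolding R_def by auto
      then show ?thesis using swap[of v v' B] differ mixed by (auto simp: R_def)
    next
      case odds
      \<comment> \<open>All in-degrees on \<open>I\<close> are odd, so each one other than 1 costs
        two extra arcs, and only two extra arcs are available. Hence at least
        \<open>CARD('a) - 3\<close> points have in-degree 1, and no leaves are needed in the
        split.\<close>
      define I where "I = - {v, v'}"
      define S where "S = {x \<in> I. indeg f x = 1}"
      have "card {v, v'} = 2" using dist by simp
      then have cardI: "card I + 2 = CARD('a)"
        using cardC[of "{v, v'}"] N by (simp add: I_def)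
      have sumI: "(\<Sum>x\<in>I. indeg f x) \<le> CARD('a)"
        using total[of I] by simp
      have "indeg f x \<ge> 1 + 2 * of_bool (x \<notin> S)" if "x \<in> I" for x
      proof -
        have "odd (indeg f x)" using odds that by (auto simp: I_def R_def)
        then show ?thesis using that by (cases "indeg f x = 1") (auto simp: S_def elim!: oddE)
      qed
      then have "(\<Sum>x\<in>I. 1 + 2 * of_bool (x \<notin> S)) \<le> (\<Sum>x\<in>I. indeg f x)"
        by (intro sum_mono) auto
      moreover have "(\<Sum>x\<in>I. 1 + 2 * of_bool (x \<notin> S)) = card I + 2 * card (I - S)"
        unfolding sum.distrib sum_distrib_left[symmetric] by (simp add: Diff_eq Compl_eq)
      moreover have "card (I - S) = card I - card S" "card S \<le> card I"
        by (auto simp: S_def card_Diff_subset intro: card_mono)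
      ultimately have "CARD('a) \<le> card S + 3"
        using sumI cardI by linarith
      then show ?thesis
        using N by (intro balanced_split_leaves_ones[of S f "{}"]) (auto simp: S_def)
    next
      case eves
      show ?thesis
      \<comment> \<open>A leaf with a third image enters a point of \<open>R\<close>, whose
        in-degree is even, and \<open>evens\<close> applies. Otherwise all leaves enter
        \<open>?t\<close> or \<open>?t'\<close>, and the remaining points have in-degree at least 2,
        which would force almost all points to be leaves.\<close>
      proof (cases "f ` L \<subseteq> {?t, ?t'}")
        case False
        then obtain u where u: "u \<in> L" "f u \<notin> {?t, ?t'}" by blast
        moreover have "f u \<in> R" using u differ fL[of u] by (auto simp: R_def)
        ultimately show ?thesis using evens[of u v] differ eves by auto
      next
        case True
        define I where "I = - (L \<union> {?t, ?t'})"
        have "card (L \<union> {?t, ?t'}) \<le> card L + 2"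
          using card_Un_le[of L "{?t, ?t'}"] by (simp add: card_insert_if split: if_splits)
        then have cardI: "CARD('a) \<le> card I + card L + 2"
          using cardC[of "L \<union> {?t, ?t'}"] by (simp add: I_def)
        have "indeg f x \<ge> 2" if "x \<in> I" for x
        proof -
          have "even (indeg f x)" "indeg f x \<noteq> 0"
            using that eves differ L0[of x] by (auto simp: I_def R_def)
          then show ?thesis by (auto elim!: evenE)
        qed
        then have "(\<Sum>x\<in>I. 2) \<le> (\<Sum>x\<in>I. indeg f x)"
          by (intro sum_mono) auto
        moreover have "card L \<le> card (f -` {?t, ?t'})"
          using True by (intro card_mono) auto
        moreover have "(\<Sum>x\<in>{?t, ?t'}. indeg f x) \<le> (\<Sum>x\<in>-I. indeg f x)"
          by (intro sum_mono2) (auto simp: I_def)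
        ultimately have "2 * card I + card L \<le> CARD('a)"
          using total[of I] by (simp add: card_vimage_eq_sum_indeg)
        then have False using cardI differ(1) q N by linarith
        then show ?thesis ..
      qed
    qed
  qed
qed

section \<open>Renaming configurations so that an arc disappears\<close>

lemma exists_bij_same_fibres:
  fixes \<alpha> :: "'a::finite \<Rightarrow> 'c" and \<beta> :: "'a \<Rightarrow> 'c"
  assumes "\<And>k. card (\<alpha> -` {k}) = card (\<beta> -` {k})"
  obtains \<pi> where "bij \<pi>" "\<beta> \<circ> \<pi> = \<alpha>"
proof -
  have "\<exists>h. bij_betw h (\<alpha> -` {k}) (\<beta> -` {k})" for k
    using assms by (intro finite_same_card_bij) auto
  then obtain h where h: "\<And>k. bij_betw (h k) (\<alpha> -` {k}) (\<beta> -` {k})"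
    by metis
  define \<pi> where "\<pi> x = h (\<alpha> x) x" for x
  have \<beta>: "\<beta> (\<pi> x) = \<alpha> x" for x
    using bij_betwE[OF h[of "\<alpha> x"]] by (auto simp: \<pi>_def)
  have "inj \<pi>"
  proof (rule injI)
    fix x y assume eq: "\<pi> x = \<pi> y"
    then have "\<alpha> x = \<alpha> y" using \<beta> by metis
    then show "x = y"
      using eq bij_betw_imp_inj_on[OF h[of "\<alpha> x"]] by (auto simp: \<pi>_def inj_on_def)
  qed
  then have "bij \<pi>" by (simp add: bij_def finite_UNIV_inj_surj)
  then show ?thesis using that \<beta> by (auto simp: fun_eq_iff)
qed

instance bit :: finite
proof
  have "UNIV = {0, 1 :: bit}" by (auto intro: bit.exhaust)
  then show "finite (UNIV :: bit set)" by (metis finite.emptyI finite.insertI)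
qed

lemma card_bit: "CARD(bit) = 2"
proof -
  have "UNIV = {0, 1 :: bit}" by (auto intro: bit.exhaust)
  then show ?thesis by (metis card_2_iff zero_neq_one)
qed

lemma config_flip_twice [simp]: "x + axis j 1 + axis j 1 = (x :: 'n::finite config)"
  by (simp add: vec_eq_iff axis_def)

lemma card_half_config:
  fixes i :: "'n::finite"
  assumes "\<And>y. P (y + axis i 1) \<longleftrightarrow> P y"
  shows "2 * card {y :: 'n config. y $ i = a \<and> P y} = card {y :: 'n config. P y}"
proof -
  let ?H = "\<lambda>a. {y :: 'n config. y $ i = a \<and> P y}"
  have "bij_betw (\<lambda>y. y + axis i 1) (?H a) (?H (a + 1))"
    by (rule bij_betwI[where g = "\<lambda>y. y + axis i 1"]) (auto simp: assms)
  then have "card (?H a) = card (?H (a + 1))" by (rule bij_betw_same_card)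
  moreover have "{y. P y} = ?H a \<union> ?H (a + 1)"
    by (cases a) auto
  moreover have "?H a \<inter> ?H (a + 1) = {}" by auto
  ultimately show ?thesis by (simp add: card_Un_disjoint)
qed

text \<open>Choose \<open>m div 2\<close> points with coordinate \<open>j\<close> equal to 0 in the
  half and add their flips, which stay in the half because \<open>i \<noteq> j\<close>. A quarter of
  all configurations is available for this choice.\<close>

lemma flip_invariant_subset:
  fixes i j :: "'n::finite"
  assumes "i \<noteq> j" "even m" "2 * m \<le> CARD('n config)"
  shows "\<exists>T \<subseteq> {y :: 'n config. y $ i = a}. card T = m \<and> (\<forall>y. y + axis j 1 \<in> T \<longleftrightarrow> y \<in> T)"
proof -
  let ?Q = "{y :: 'n config. y $ j = 0 \<and> y $ i = a}"
  have "2 * card ?Q = card {y :: 'n config. y $ i = a}"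
    using assms(1) by (intro card_half_config) (auto simp: axis_def)
  also have "2 * \<dots> = CARD('n config)"
    using card_half_config[of "\<lambda>_. True" i a] by simp
  finally have "m div 2 \<le> card ?Q" using assms(3) by simp
  from obtain_subset_with_card_n[OF this]
  obtain U where U: "U \<subseteq> ?Q" "card U = m div 2" "finite U" .
  let ?s = "\<lambda>y :: 'n config. y + axis j 1"
  have "card (?s ` U) = card U" by (intro card_image) (auto simp: inj_on_def)
  moreover have "U \<inter> ?s ` U = {}"
  proof -
    have "y $ j = 0" if "y \<in> U" for y using U(1) that by auto
    moreover have "y $ j = 1" if "y \<in> ?s ` U" for y using U(1) that by (auto simp: axis_def)
    ultimately show ?thesis by (metis disjoint_iff zero_neq_one)
  qed
  ultimately have "card (U \<union> ?s ` U) = m"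
    using U assms(2) by (auto simp: card_Un_disjoint elim!: evenE)
  moreover have "y + axis j 1 \<in> U \<union> ?s ` U \<longleftrightarrow> y \<in> U \<union> ?s ` U" for y
    by (auto simp: image_iff) (metis config_flip_twice)+
  moreover have "U \<union> ?s ` U \<subseteq> {y. y $ i = a}"
    using U assms(1) by (auto simp: axis_def)
  ultimately show ?thesis by blast
qed

theorem theorem2:
  fixes f :: "'n::finite network"
  assumes "CARD('n) \<ge> 5"
  shows "interaction_graphs f \<noteq> {complete_looped_digraph}"
proof -
  let ?N = "CARD('n config)"
  have N: "?N = 2 ^ 5 * 2 ^ (CARD('n) - 5)"
    using power_add[of "2 :: nat" 5 "CARD('n) - 5"] assms by (simp add: card_bit)
  have "4 dvd ?N" "32 \<le> ?N"
    by (simp_all only: N) auto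
  then obtain A where A: "2 * card A = ?N" "even (card (f -` A))" "even (card (A \<inter> f -` A))"
    using balanced_split_exists[of f] by (auto simp: balanced_split_def inner_arcs_def)
  obtain i j :: 'n where ij: "i \<noteq> j"
    using assms card_le_Suc0_iff_eq[of "UNIV :: 'n set"] by force
  have cA: "2 * card (- A) = ?N" using A(1) by (simp add: Compl_eq_Diff_UNIV card_Diff_subset)
  have "card (f -` A) = card (A \<inter> f -` A) + card (- A \<inter> f -` A)"
    by (subst card_Un_disjoint[symmetric]) (auto intro: arg_cong[where f = card])
  then have "even (card (- A \<inter> f -` A))" using A by simp
  moreover have "2 * card (A \<inter> f -` A) \<le> ?N" "2 * card (- A \<inter> f -` A) \<le> ?N"
    using A(1) cA card_mono[of A "A \<inter> f -` A"] card_mono[of "- A" "- A \<inter> f -` A"] by auto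
  ultimately obtain T0 :: "'n config set" where T0: "T0 \<subseteq> {y. y $ i = 0}" "card T0 = card (- A \<inter> f -` A)"
      "\<And>y. y + axis j 1 \<in> T0 \<longleftrightarrow> y \<in> T0"
    using flip_invariant_subset[OF ij, of "card (- A \<inter> f -` A)" 0] by blast
  obtain T1 :: "'n config set" where T1: "T1 \<subseteq> {y. y $ i = 1}" "card T1 = card (A \<inter> f -` A)"
      "\<And>y. y + axis j 1 \<in> T1 \<longleftrightarrow> y \<in> T1"
    using flip_invariant_subset[OF ij, of "card (A \<inter> f -` A)" 1] A(3)
      \<open>2 * card (A \<inter> f -` A) \<le> ?N\<close> by blast
  define \<alpha> where "\<alpha> x = (x \<in> A, f x \<in> A)" for x
  define \<beta> where "\<beta> y = (y $ i = 1, y \<in> T0 \<union> T1)" for y :: "'n config"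
  have half: "2 * card {y :: 'n config. y $ i = a} = ?N" for a
    using card_half_config[of "\<lambda>_. True" i a] by simp
  have "card (\<alpha> -` {k}) = card (\<beta> -` {k})" for k
  proof -
    have "\<beta> -` {(True, True)} = T1" "\<beta> -` {(False, True)} = T0"
      "\<beta> -` {(True, False)} = {y. y $ i = 1} - T1" "\<beta> -` {(False, False)} = {y. y $ i = 0} - T0"
      using T0(1) T1(1) by (auto simp: \<beta>_def)
    moreover have "\<alpha> -` {(True, True)} = A \<inter> f -` A" "\<alpha> -` {(False, True)} = - A \<inter> f -` A"
      "\<alpha> -` {(True, False)} = A - A \<inter> f -` A" "\<alpha> -` {(False, False)} = - A - (- A \<inter> f -` A)"
      by (auto simp: \<alpha>_def)
    moreover have "card A = card {y :: 'n config. y $ i = 1}"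
      "card (- A) = card {y :: 'n config. y $ i = 0}"
      using half[of 1] half[of 0] A(1) cA by linarith+
    ultimately show ?thesis
      using T0(1,2) T1(1,2)
      by (cases k; cases "fst k"; cases "snd k") (auto simp: card_Diff_subset)
  qed
  then obtain \<pi> where \<pi>: "bij \<pi>" "\<beta> \<circ> \<pi> = \<alpha>"
    using exists_bij_same_fibres by blast
  define h where "h = \<pi> \<circ> f \<circ> inv \<pi>"
  have iso: "isomorphic_networks f h"
    unfolding isomorphic_networks_def h_def using \<pi>(1)
    by (intro exI[of _ \<pi>]) (simp add: fun_eq_iff bij_is_inj)
  have hi: "h y $ i = 1 \<longleftrightarrow> y \<in> T0 \<union> T1" for y
  proof -
    have "\<beta> (\<pi> x) = \<alpha> x" for x using \<pi>(2) by (metis comp_apply)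
    from this[of "inv \<pi> y"] this[of "f (inv \<pi> y)"] show ?thesis
      using \<pi>(1) by (simp add: \<alpha>_def \<beta>_def h_def bij_is_surj surj_f_inv_f)
  qed
  have "h y $ i = h (y + axis j 1) $ i" for y
  proof -
    have "h y $ i = 1 \<longleftrightarrow> h (y + axis j 1) $ i = 1"
      unfolding hi using T0(3) T1(3) by simp
    then show ?thesis by (cases "h y $ i"; cases "h (y + axis j 1) $ i") simp_all
  qed
  then have "(j, i) \<notin> parcs (interaction_graph h)"
    by (simp add: interaction_graph_def)
  then have "interaction_graph h \<noteq> complete_looped_digraph"
    by (auto simp: complete_looped_digraph_def)
  then show ?thesis using iso by (auto simp: interaction_graphs_def)
qed

end
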